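(* Let $K=\mathbb{F}_q$ be the finite field with $q=p^k$ elements, where $p$ is a prime number and $k$ is a positive integer, let $n\ge 1$, and let $S\subseteq \mathbb{F}_q^n$ be a nonempty subset. If $J$ is a proper ideal of the coordinate ring $K[S]$, then $I_S(V_S(J))=J$.
   Context: For $S\subseteq K^n$, let $I(S)=\{f\in K[x_1,\dots,x_n] : f(\mathbf a)=0 \text{ for all } \mathbf a\in S\}$, and let $K[S]=K[x_1,\dots,x_n]/I(S)$ be the coordinate ring of $S$; its elements are regarded as polynomial functions $S\to K$, so $\phi(\mathbf a)$ is well defined for $\phi\in K[S]$, $\mathbf a\in S$. For an ideal $J$ of $K[S]$, $V_S(J)=\{\mathbf a\in S : \phi(\mathbf a)=0 \text{ for all } \phi\in J\}$. For a subset $T\subseteq S$, $I_S(T)=\{\phi\in K[S] : \phi(\mathbf a)=0 \text{ for all } \mathbf a\in T\}$. *)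

theory Defs
  imports
    "HOL-Analysis.Finite_Cartesian_Product"
    "HOL-Library.Poly_Mapping"
    "HOL-Algebra.Algebraic_Closure_Type"
begin

text \<open>
  Polynomials over \<open>'k\<close> in the variables \<open>x\<^sub>i\<close>, for \<open>i\<close> in the finite type \<open>'n\<close>, are the finitely
  supported maps from exponent vectors to coefficients; multiplication is convolution.
\<close>

type_synonym ('n, 'k) mpoly = "('n \<Rightarrow>\<^sub>0 nat) \<Rightarrow>\<^sub>0 'k"

abbreviation mpoly_ring :: "('n, 'k::comm_ring_1) mpoly ring"
  where "mpoly_ring \<equiv> ring_of_type_algebra"

definition monom_eval :: "('n::finite \<Rightarrow>\<^sub>0 nat) \<Rightarrow> 'k::comm_ring_1 ^ 'n \<Rightarrow> 'k"
  where "monom_eval m a = (\<Prod>i\<in>UNIV. (a $ i) ^ Poly_Mapping.lookup m i)"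

definition mpoly_eval :: "('n::finite, 'k::comm_ring_1) mpoly \<Rightarrow> 'k ^ 'n \<Rightarrow> 'k"
  where "mpoly_eval f a = (\<Sum>m\<in>Poly_Mapping.keys f. Poly_Mapping.lookup f m * monom_eval m a)"

definition vanishing_ideal :: "('k::comm_ring_1 ^ 'n::finite) set \<Rightarrow> ('n, 'k) mpoly set"
  where "vanishing_ideal S = {f. \<forall>a\<in>S. mpoly_eval f a = 0}"

definition coord_ring :: "('k::comm_ring_1 ^ 'n::finite) set \<Rightarrow> ('n, 'k) mpoly set ring"
  where "coord_ring S = mpoly_ring Quot vanishing_ideal S"

text \<open>
  An element of the coordinate ring is a coset of polynomials. Its value at a point is the common
  value of its representatives; this is meaningful only at points of \<open>S\<close>, see \<open>coord_eval_coset\<close>.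
\<close>

definition coord_eval :: "('n::finite, 'k::comm_ring_1) mpoly set \<Rightarrow> 'k ^ 'n \<Rightarrow> 'k"
  where "coord_eval \<phi> a = the_elem ((\<lambda>f. mpoly_eval f a) ` \<phi>)"

definition zero_locus_in ::
    "('k::comm_ring_1 ^ 'n::finite) set \<Rightarrow> ('n, 'k) mpoly set set \<Rightarrow> ('k ^ 'n) set"
  where "zero_locus_in S J = {a \<in> S. \<forall>\<phi>\<in>J. coord_eval \<phi> a = 0}"

definition vanishing_ideal_in ::
    "('k::comm_ring_1 ^ 'n::finite) set \<Rightarrow> ('k ^ 'n) set \<Rightarrow> ('n, 'k) mpoly set set"
  where "vanishing_ideal_in S T = {\<phi> \<in> carrier (coord_ring S). \<forall>a\<in>T. coord_eval \<phi> a = 0}"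


lemma mpoly_eval_superset:
  assumes "finite A" "Poly_Mapping.keys f \<subseteq> A"
  shows "mpoly_eval f a = (\<Sum>m\<in>A. Poly_Mapping.lookup f m * monom_eval m a)"
  unfolding mpoly_eval_def
  by (rule sum.mono_neutral_left) (use assms in \<open>auto simp: in_keys_iff\<close>)

lemma mpoly_eval_0 [simp]: "mpoly_eval 0 a = 0"
  by (simp add: mpoly_eval_def)

lemma mpoly_eval_add: "mpoly_eval (f + g) a = mpoly_eval f a + mpoly_eval g a"
proof -
  let ?A = "Poly_Mapping.keys f \<union> Poly_Mapping.keys g"
  have "finite ?A" by simp
  moreover have "Poly_Mapping.keys (f + g) \<subseteq> ?A" by (rule Poly_Mapping.keys_add)
  ultimately show ?thesis
    by (simp add: mpoly_eval_superset[of ?A] lookup_add distrib_right sum.distrib)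
qed

lemma mpoly_eval_single: "mpoly_eval (Poly_Mapping.single m c) a = c * monom_eval m a"
  by (subst mpoly_eval_superset[of "{m}"]) auto

lemma mpoly_eval_uminus: "mpoly_eval (- f) a = - mpoly_eval f a"
  using mpoly_eval_add[of f "- f" a] by (simp add: minus_unique)

lemma monom_eval_add: "monom_eval (m + m') a = monom_eval m a * monom_eval m' a"
  by (simp add: monom_eval_def lookup_add power_add prod.distrib)

lemma mpoly_induct [case_names zero add_single]:
  fixes f :: "('n, 'k::comm_ring_1) mpoly"
  assumes "P 0" "\<And>f m c. P f \<Longrightarrow> P (f + Poly_Mapping.single m c)"
  shows "P f"
proof (induction f rule: update_induct)
  case const
  then show ?case using assms(1) by simp
next
  case (update f m c)
  have "Poly_Mapping.update m c f = f + Poly_Mapping.single m c"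
    using update(1) by (intro poly_mapping_eqI) (auto simp: lookup_update lookup_add lookup_single in_keys_iff)
  then show ?case using assms(2) update by simp
qed

lemma mpoly_eval_mult: "mpoly_eval (f * g) a = mpoly_eval f a * mpoly_eval g a"
proof (induction f rule: mpoly_induct)
  case (add_single f m c)
  have "mpoly_eval (Poly_Mapping.single m c * g) a = c * monom_eval m a * mpoly_eval g a"
    by (induction g rule: mpoly_induct)
      (simp_all add: distrib_left mpoly_eval_add mult_single mpoly_eval_single monom_eval_add mult_ac)
  with add_single show ?case
    by (simp add: distrib_right mpoly_eval_add mpoly_eval_single)
qed simp

lemma vanishing_ideal_ideal:
  fixes S :: "('k::comm_ring_1 ^ 'n::finite) set"
  shows "ideal (vanishing_ideal S) mpoly_ring"
proof -
  interpret ring "mpoly_ring :: ('n, 'k) mpoly ring" by (rule ring_from_type_algebra)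
  have inv: "\<ominus>\<^bsub>mpoly_ring\<^esub> f = - f" for f :: "('n, 'k) mpoly"
    by (rule minus_equality) (auto simp: ring_of_type_algebra_def)
  show ?thesis
  proof (rule idealI)
    show "ring (mpoly_ring :: ('n, 'k) mpoly ring)" by (rule ring_axioms)
    show "subgroup (vanishing_ideal S) (add_monoid mpoly_ring)"
    proof (rule add.subgroupI)
      show "vanishing_ideal S \<subseteq> carrier mpoly_ring"
        by (simp add: ring_of_type_algebra_def)
      have "0 \<in> vanishing_ideal S" by (simp add: vanishing_ideal_def)
      then show "vanishing_ideal S \<noteq> {}" by blast
      show "\<ominus>\<^bsub>mpoly_ring\<^esub> f \<in> vanishing_ideal S" if "f \<in> vanishing_ideal S" for f
        using that by (simp add: inv vanishing_ideal_def mpoly_eval_uminus)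
      show "f \<oplus>\<^bsub>mpoly_ring\<^esub> g \<in> vanishing_ideal S"
        if "f \<in> vanishing_ideal S" "g \<in> vanishing_ideal S" for f g
        using that by (simp add: ring_of_type_algebra_def vanishing_ideal_def mpoly_eval_add)
    qed
  qed (auto simp: ring_of_type_algebra_def vanishing_ideal_def mpoly_eval_mult)
qed

lemma coord_ring_cring: "cring (coord_ring S)"
  unfolding coord_ring_def
  by (rule ideal.quotient_is_cring[OF vanishing_ideal_ideal cring_from_type_algebra])

lemma carrier_coord_ring:
  fixes S :: "('k::comm_ring_1 ^ 'n::finite) set"
  shows "carrier (coord_ring S) = range (\<lambda>f. vanishing_ideal S +>\<^bsub>mpoly_ring\<^esub> f)"
proof -
  have "carrier mpoly_ring = (UNIV :: ('n, 'k) mpoly set)"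
    by (simp add: ring_of_type_algebra_def)
  then show ?thesis
    by (auto simp: coord_ring_def FactRing_def A_RCOSETS_def' a_r_coset_def')
qed

lemma coord_eval_coset:
  assumes "a \<in> S"
  shows "coord_eval (vanishing_ideal S +>\<^bsub>mpoly_ring\<^esub> f) a = mpoly_eval f a"
proof -
  have "(\<lambda>g. mpoly_eval g a) ` (vanishing_ideal S +>\<^bsub>mpoly_ring\<^esub> f) = {mpoly_eval f a}"
    using assms
    by (auto simp: a_r_coset_def r_coset_def ring_of_type_algebra_def vanishing_ideal_def
        mpoly_eval_add image_iff intro!: exI[of _ 0])
  then show ?thesis by (simp add: coord_eval_def)
qed

end

theory Submission
  imports Defs
begin

text \<open>
  Over a finite field the set \<open>S\<close> is finite, and finiteness of \<open>S\<close> is what makes the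
  correspondence exact: no radical appears. Distinct points of \<open>S\<close> are separated by a coordinate,
  so multiplying factors \<open>x\<^sub>i - b\<^sub>i\<close>, one for each \<open>b\<close> to be avoided, gives a polynomial
  that is the indicator function of a given point on \<open>S\<close> (lemma \<open>indicator_poly\<close>).
  Hence \<open>K[S]\<close> is the ring of all functions \<open>S \<rightarrow> K\<close>.

  If \<open>J\<close> has a member that does not vanish at \<open>a\<close>, then multiplying that member by the
  indicator of \<open>a\<close> and rescaling gives every function supported at \<open>a\<close>
  (lemma \<open>point_mass_in_ideal\<close>). A function \<open>\<phi>\<close> that vanishes on \<open>V\<^sub>S(J)\<close> is the sum of its
  restrictions to the single points of \<open>S\<close>; at a point of \<open>V\<^sub>S(J)\<close> the summand is \<open>0\<close>, and at any
  other point \<open>J\<close> has such a member, so every summand, and with it \<open>\<phi>\<close>, lies in \<open>J\<close>.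
\<close>

lemma mpoly_eval_one [simp]: "mpoly_eval 1 a = 1"
  using mpoly_eval_single[of 0 1 a] by (simp add: monom_eval_def)

lemma mpoly_eval_sum: "mpoly_eval (\<Sum>x\<in>A. f x) a = (\<Sum>x\<in>A. mpoly_eval (f x) a)"
  by (induction A rule: infinite_finite_induct) (simp_all add: mpoly_eval_add)

lemma mpoly_eval_prod: "mpoly_eval (\<Prod>x\<in>A. f x) a = (\<Prod>x\<in>A. mpoly_eval (f x) a)"
  by (induction A rule: infinite_finite_induct) (simp_all add: mpoly_eval_mult)

lemma mpoly_eval_const [simp]: "mpoly_eval (Poly_Mapping.single 0 c) a = c"
  by (simp add: mpoly_eval_single monom_eval_def)

lemma mpoly_eval_var [simp]:
  "mpoly_eval (Poly_Mapping.single (Poly_Mapping.single i 1) 1) a = a $ i"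
proof -
  have "monom_eval (Poly_Mapping.single i 1) a = (\<Prod>j\<in>UNIV. if j = i then a $ i else 1)"
    unfolding monom_eval_def by (intro prod.cong) (auto simp: lookup_single)
  then show ?thesis by (simp add: mpoly_eval_single)
qed

lemma separating_poly:
  fixes a b :: "'k::comm_ring_1 ^ 'n::finite"
  assumes "a \<noteq> b"
  shows "\<exists>f. mpoly_eval f a \<noteq> 0 \<and> mpoly_eval f b = 0"
proof -
  obtain i where i: "a $ i \<noteq> b $ i" using assms by (auto simp: vec_eq_iff)
  let ?f = "Poly_Mapping.single (Poly_Mapping.single i 1) 1 + Poly_Mapping.single 0 (- (b $ i))"
  have "mpoly_eval ?f c = c $ i - b $ i" for c
    unfolding mpoly_eval_add mpoly_eval_var mpoly_eval_const by simp
  with i show ?thesis by (intro exI[of _ ?f]) simp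
qed

text \<open>
  The multivariate form of a Lagrange basis polynomial: a product of separating factors, normalised
  by its value at \<open>a\<close>.
\<close>

lemma indicator_poly:
  fixes a :: "'k::field ^ 'n::finite"
  assumes "finite S"
  shows "\<exists>e. \<forall>b\<in>S. mpoly_eval e b = (if b = a then 1 else 0)"
proof -
  have "\<exists>f. mpoly_eval f a \<noteq> 0 \<and> mpoly_eval f b = 0" if "b \<in> S - {a}" for b
    using that separating_poly[of a b] by blast
  then obtain f where f: "\<And>b. b \<in> S - {a} \<Longrightarrow> mpoly_eval (f b) a \<noteq> 0 \<and> mpoly_eval (f b) b = 0"
    by metis
  define g where "g = (\<Prod>b\<in>S - {a}. f b)"
  have ga: "mpoly_eval g a \<noteq> 0"
    using f assms by (simp add: g_def mpoly_eval_prod)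
  have gb: "mpoly_eval g b = 0" if "b \<in> S" "b \<noteq> a" for b
    using f[of b] assms that by (auto simp: g_def mpoly_eval_prod intro!: prod_zero)
  have "mpoly_eval (Poly_Mapping.single 0 (inverse (mpoly_eval g a)) * g) b = (if b = a then 1 else 0)"
    if "b \<in> S" for b
    using ga gb that by (simp add: mpoly_eval_mult)
  then show ?thesis by blast
qed

abbreviation coord_class ::
    "('k::comm_ring_1 ^ 'n::finite) set \<Rightarrow> ('n, 'k) mpoly \<Rightarrow> ('n, 'k) mpoly set"
  where "coord_class S f \<equiv> vanishing_ideal S +>\<^bsub>mpoly_ring\<^esub> f"

lemma coord_class_conv: "coord_class S f = {g. \<forall>a\<in>S. mpoly_eval g a = mpoly_eval f a}"
proof (rule Set.set_eqI, rule iffI)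
  fix g assume "g \<in> coord_class S f"
  then show "g \<in> {g. \<forall>a\<in>S. mpoly_eval g a = mpoly_eval f a}"
    by (auto simp: a_r_coset_def r_coset_def ring_of_type_algebra_def vanishing_ideal_def
        mpoly_eval_add)
next
  fix g assume g: "g \<in> {g. \<forall>a\<in>S. mpoly_eval g a = mpoly_eval f a}"
  have "g - f \<in> vanishing_ideal S"
    using g mpoly_eval_add[of "g - f" f] by (simp add: vanishing_ideal_def)
  moreover have "g = (g - f) + f" by simp
  ultimately show "g \<in> coord_class S f"
    unfolding a_r_coset_def r_coset_def ring_of_type_algebra_def by fastforce
qed

lemma coord_class_hom: "coord_class S \<in> ring_hom mpoly_ring (coord_ring S)"
  unfolding coord_ring_def by (rule ideal.rcos_ring_hom[OF vanishing_ideal_ideal])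

lemma coord_class_in_carrier: "coord_class S f \<in> carrier (coord_ring S)"
  by (simp add: carrier_coord_ring)

lemma coord_class_zero: "coord_class S 0 = \<zero>\<^bsub>coord_ring S\<^esub>"
  using ring_hom_zero[OF coord_class_hom ring_from_type_algebra cring.axioms(1)[OF coord_ring_cring]]
  by (simp add: ring_of_type_algebra_def)

lemma coord_class_add: "coord_class S (f + g) = coord_class S f \<oplus>\<^bsub>coord_ring S\<^esub> coord_class S g"
  using ring_hom_add[OF coord_class_hom, of f g] by (simp add: ring_of_type_algebra_def)

lemma coord_class_mult: "coord_class S (f * g) = coord_class S f \<otimes>\<^bsub>coord_ring S\<^esub> coord_class S g"
  using ring_hom_mult[OF coord_class_hom, of f g] by (simp add: ring_of_type_algebra_def)

lemma coord_class_sum_in_ideal: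
  assumes J: "ideal J (coord_ring S)" and "\<And>x. x \<in> A \<Longrightarrow> coord_class S (h x) \<in> J"
  shows "coord_class S (\<Sum>x\<in>A. h x) \<in> J"
proof -
  interpret ideal J "coord_ring S" by (rule J)
  show ?thesis
    using assms(2)
    by (induction A rule: infinite_finite_induct)
      (simp_all add: coord_class_zero coord_class_add)
qed

text \<open>
  Away from the zero locus of \<open>J\<close> some member of \<open>J\<close> is invertible at \<open>a\<close>, and a multiple of it
  takes any prescribed value there and vanishes at all other points.
\<close>

lemma point_mass_in_ideal:
  fixes S :: "('k::field ^ 'n::finite) set"
  assumes "finite S" and J: "ideal J (coord_ring S)" and a: "a \<in> S" "a \<notin> zero_locus_in S J"
  shows "\<exists>h. coord_class S h \<in> J \<and> (\<forall>b\<in>S. mpoly_eval h b = (if b = a then c else 0))"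
proof -
  interpret ideal J "coord_ring S" by (rule J)
  obtain \<psi> where \<psi>: "\<psi> \<in> J" "coord_eval \<psi> a \<noteq> 0"
    using a by (auto simp: zero_locus_in_def)
  then obtain g where g: "\<psi> = coord_class S g"
    using Icarr by (auto simp: carrier_coord_ring)
  have ga: "mpoly_eval g a \<noteq> 0"
    using \<psi>(2) a(1) by (simp add: g coord_eval_coset)
  obtain e where e: "\<forall>b\<in>S. mpoly_eval e b = (if b = a then 1 else 0)"
    using indicator_poly[OF \<open>finite S\<close>] by blast
  define h where "h = Poly_Mapping.single 0 (c / mpoly_eval g a) * e * g"
  have "coord_class S h \<in> J"
    unfolding h_def coord_class_mult[of S _ g]
    using \<psi>(1) g by (intro I_l_closed coord_class_in_carrier) simp
  moreover have "\<forall>b\<in>S. mpoly_eval h b = (if b = a then c else 0)"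
    using e ga by (simp add: h_def mpoly_eval_mult)
  ultimately show ?thesis by blast
qed

theorem vanishing_ideal_zero_locus_finite:
  fixes S :: "('k::field ^ 'n::finite) set"
  assumes "finite S" and J: "ideal J (coord_ring S)"
  shows "vanishing_ideal_in S (zero_locus_in S J) = J"
proof
  interpret ideal J "coord_ring S" by (rule J)
  show "J \<subseteq> vanishing_ideal_in S (zero_locus_in S J)"
    using Icarr by (auto simp: vanishing_ideal_in_def zero_locus_in_def)
  show "vanishing_ideal_in S (zero_locus_in S J) \<subseteq> J"
  proof
    fix \<phi> assume \<phi>: "\<phi> \<in> vanishing_ideal_in S (zero_locus_in S J)"
    then obtain f where f: "\<phi> = coord_class S f"
      by (auto simp: vanishing_ideal_in_def carrier_coord_ring)
    have "\<exists>h. coord_class S h \<in> J \<and>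
        (\<forall>b\<in>S. mpoly_eval h b = (if b = a then mpoly_eval f a else 0))" if a: "a \<in> S" for a
    proof (cases "a \<in> zero_locus_in S J")
      case True
      with \<phi> have "mpoly_eval f a = 0"
        using a by (auto simp: vanishing_ideal_in_def f coord_eval_coset)
      then show ?thesis by (intro exI[of _ 0]) (simp add: coord_class_zero)
    next
      case False
      with assms a show ?thesis by (intro point_mass_in_ideal)
    qed
    then obtain h where hJ: "\<And>a. a \<in> S \<Longrightarrow> coord_class S (h a) \<in> J"
      and h: "\<And>a b. \<lbrakk>a \<in> S; b \<in> S\<rbrakk> \<Longrightarrow>
        mpoly_eval (h a) b = (if b = a then mpoly_eval f a else 0)"
      by metis
    have "mpoly_eval (\<Sum>a\<in>S. h a) b = mpoly_eval f b" if "b \<in> S" for b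
      using that h \<open>finite S\<close> by (simp add: mpoly_eval_sum)
    then have "\<phi> = coord_class S (\<Sum>a\<in>S. h a)"
      by (simp add: f coord_class_conv)
    also have "\<dots> \<in> J"
      using J hJ by (rule coord_class_sum_in_ideal)
    finally show "\<phi> \<in> J" .
  qed
qed

theorem theorem1:
  fixes p k :: nat
    and S :: "('k::{field, finite} ^ 'n::finite) set"
    and J :: "('n, 'k) mpoly set set"
  assumes "Factorial_Ring.prime p" and "k > 0" and "CARD('k) = p ^ k"
    and "S \<noteq> {}"
    and "ideal J (coord_ring S)" and "J \<noteq> carrier (coord_ring S)"
  shows "vanishing_ideal_in S (zero_locus_in S J) = J"
  using assms by (intro vanishing_ideal_zero_locus_finite) simp_all

end
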